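(* Let $N\ge1$, let $x_1,\dots,x_N>0$, let $0<\lambda_{\min}\le\lambda_{\max}$, and let $\Lambda=\{\boldsymbol\lambda=(\lambda_1,\dots,\lambda_N):\lambda_{\min}\le\lambda_n\le\lambda_{\max}\ \forall n\}$. For each $n$ let $C_n:[0,\infty)\to\mathbb{R}$ be a quasiconvex and non-decreasing function with $C_n(0)=0$. Let $\boldsymbol\lambda^*$ be an optimal solution of $$\min_{\boldsymbol\lambda\in\Lambda}\ C_{\mathrm{sys}}(\boldsymbol\lambda),\qquad C_{\mathrm{sys}}(\boldsymbol\lambda)=\max_{n}C_n\!\left(x_n+\frac{1+\sum_{k=1}^N\lambda_kx_k}{\lambda_n}\right).$$ Then: (i) there exists $\hat{\boldsymbol\lambda}\succeq\boldsymbol\lambda^*$ such that $\max_n\hat\lambda_n=\lambda_{\max}$ and $C_{\mathrm{sys}}(\hat{\boldsymbol\lambda})=C_{\mathrm{sys}}(\boldsymbol\lambda^* )$; (ii) if all entities are identical, i.e. $x_n=x_m$ and $C_n(A)=C_m(A)$ for all $n,m$ and all $A\ge 0$, then $\lambda_n=\lambda_{\max}$ for all $n$ is an optimal solution.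
   Context: Here $x_n$ is the mean service time, $\lambda_n$ the update rate and $C_n$ the cost function of entity $n$. The relation $\succeq$ denotes entrywise "larger than or equal to" for vectors. *)

theory Defs
  imports "HOL-Analysis.Analysis"
begin

definition quasiconvex_on :: "'a::real_vector set \<Rightarrow> ('a \<Rightarrow> real) \<Rightarrow> bool" where
  "quasiconvex_on S f \<longleftrightarrow> convex S \<and>
     (\<forall>a\<in>S. \<forall>b\<in>S. \<forall>u\<ge>0. \<forall>v\<ge>0. u + v = 1 \<longrightarrow>
        f (u *\<^sub>R a + v *\<^sub>R b) \<le> max (f a) (f b))"

text \<open>Entities are indexed by a finite type, so that their number is \<open>CARD('n) \<ge> 1\<close>. The order on
  \<open>real ^ 'n\<close> is the componentwise one. The cost functions live on \<open>[0, \<infinity>)\<close>; as total functions their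
  values at negative arguments are irrelevant, since the system cost is only considered at
  positive rates.\<close>

definition rate_set :: "real \<Rightarrow> real \<Rightarrow> (real ^ 'n) set" where
  "rate_set lmin lmax = {lam. \<forall>n. lmin \<le> lam $ n \<and> lam $ n \<le> lmax}"

definition sys_cost ::
    "real ^ 'n \<Rightarrow> ('n::finite \<Rightarrow> real \<Rightarrow> real) \<Rightarrow> real ^ 'n \<Rightarrow> real" where
  "sys_cost x C lam =
     (MAX n. C n (x $ n + (1 + (\<Sum>k\<in>UNIV. lam $ k * x $ k)) / lam $ n))"

definition optimal_rates ::
    "real \<Rightarrow> real \<Rightarrow> real ^ 'n \<Rightarrow> ('n::finite \<Rightarrow> real \<Rightarrow> real) \<Rightarrow> real ^ 'n \<Rightarrow> bool" where
  "optimal_rates lmin lmax x C =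
     is_arg_min (sys_cost x C) (\<lambda>lam. lam \<in> rate_set lmin lmax)"

end

theory Submission
  imports Defs
begin

text \<open>
  Write the argument of the \<open>n\<close>-th cost as
  \<open>age\<^sub>n = x\<^sub>n + 1 / \<lambda>\<^sub>n + (\<Sum>k. \<lambda>\<^sub>k x\<^sub>k) / \<lambda>\<^sub>n\<close>. Only the term \<open>1 / \<lambda>\<^sub>n\<close> changes when all rates are
  multiplied by the same \<open>c \<ge> 1\<close>, and it shrinks; so the scaling lowers every age, and by
  monotonicity every cost. Scaling an optimum until its largest rate is \<open>\<lambda>\<^sub>m\<^sub>a\<^sub>x\<close> remains feasible
  and thus remains optimal.

  For identical entities, look at the entity \<open>m\<close> with the smallest rate. Each ratio
  \<open>\<lambda>\<^sub>k / \<lambda>\<^sub>m\<close> is at least \<open>1\<close>, and it is exactly \<open>1\<close> when all rates agree; moreover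
  \<open>1 / \<lambda>\<^sub>m \<ge> 1 / \<lambda>\<^sub>m\<^sub>a\<^sub>x\<close>. So \<open>age\<^sub>m\<close> is at least the common age under the uniform rate \<open>\<lambda>\<^sub>m\<^sub>a\<^sub>x\<close>.
  Since the system cost is a maximum, this one entity already makes it at least as large as the cost of the uniform rates.
\<close>

definition age :: "real ^ 'n \<Rightarrow> real ^ 'n \<Rightarrow> 'n::finite \<Rightarrow> real" where
  "age x lam n = x $ n + (1 + (\<Sum>k\<in>UNIV. lam $ k * x $ k)) / lam $ n"

lemma sys_cost_eq_Max_age: "sys_cost x C lam = (MAX n. C n (age x lam n))"
  by (simp add: sys_cost_def age_def)

lemma age_nonneg:
  assumes "\<And>n. 0 < x $ n" and "\<And>n. 0 < lam $ n"
  shows "0 \<le> age x lam n"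
  unfolding age_def using assms
  by (intro add_nonneg_nonneg divide_nonneg_nonneg sum_nonneg mult_nonneg_nonneg)
    (auto intro: less_imp_le)

text \<open>Both parts compare system costs in this form. In the first the dominating entity \<open>m\<close> is \<open>n\<close>
  itself, in the second it is the slowest one.\<close>

lemma sys_cost_le_if_dominated:
  assumes "\<And>n. \<exists>m. C n (age x lam n) \<le> C m (age x mu m)"
  shows "sys_cost x C lam \<le> sys_cost x C mu"
proof -
  have "C n (age x lam n) \<le> (MAX m. C m (age x mu m))" for n
  proof -
    obtain m where "C n (age x lam n) \<le> C m (age x mu m)" using assms by blast
    also have "\<dots> \<le> (MAX m. C m (age x mu m))" by (rule Max_ge) auto
    finally show ?thesis .
  qed
  then show ?thesis by (auto simp: sys_cost_eq_Max_age)
qed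

text \<open>The factor \<open>c\<close> cancels from the quotient of the load by the rate, and survives only in
  \<open>1 / (c \<lambda>\<^sub>n)\<close>.\<close>

lemma age_scale_le:
  assumes "1 \<le> c" and "0 < lam $ n"
  shows "age x (c *\<^sub>R lam) n \<le> age x lam n"
proof -
  let ?S = "\<Sum>k\<in>UNIV. lam $ k * x $ k"
  have S: "(\<Sum>k\<in>UNIV. (c *\<^sub>R lam) $ k * x $ k) = c * ?S"
    by (simp add: sum_distrib_left mult.assoc)
  have "(1 + c * ?S) / (c * lam $ n) = 1 / (c * lam $ n) + ?S / lam $ n"
    using assms by (simp add: add_divide_distrib)
  also have "\<dots> \<le> 1 / lam $ n + ?S / lam $ n"
    using assms by (intro add_right_mono divide_left_mono) auto
  finally show ?thesis
    unfolding age_def S by (simp add: add_divide_distrib)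
qed

lemma sys_cost_scale_le:
  assumes "\<And>n. 0 < x $ n" and "\<And>n. 0 < lam $ n" and "1 \<le> c"
    and "\<And>n. mono_on {0..} (C n)"
  shows "sys_cost x C (c *\<^sub>R lam) \<le> sys_cost x C lam"
proof (rule sys_cost_le_if_dominated)
  fix n
  have "0 < (c *\<^sub>R lam) $ k" for k using assms(2)[of k] assms(3) by simp
  then have "0 \<le> age x (c *\<^sub>R lam) n" using assms(1) by (intro age_nonneg)
  with age_scale_le[OF assms(3) assms(2)]
  have "C n (age x (c *\<^sub>R lam) n) \<le> C n (age x lam n)"
    by (intro mono_onD[OF assms(4)]) (auto intro: order_trans)
  then show "\<exists>m. C n (age x (c *\<^sub>R lam) n) \<le> C m (age x lam m)" ..
qed

text \<open>At the slowest entity the load \<open>\<Sum>k. \<lambda>\<^sub>k x\<^sub>k\<close> is at least \<open>\<lambda>\<^sub>m (\<Sum>k. x\<^sub>k)\<close>.\<close>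

lemma age_uniform_le_age_slowest:
  assumes "\<And>n. 0 < x $ n" and "0 < lam $ m" and "lam $ m \<le> l"
    and "\<And>k. lam $ m \<le> lam $ k"
  shows "age x (\<chi> k. l) m \<le> age x lam m"
proof -
  have l: "0 < l" using assms(2,3) by linarith
  have load: "lam $ m * (\<Sum>k\<in>UNIV. x $ k) \<le> (\<Sum>k\<in>UNIV. lam $ k * x $ k)"
    unfolding sum_distrib_left using assms(1,4)
    by (intro sum_mono mult_right_mono) (auto intro: less_imp_le)
  have "(1 + l * (\<Sum>k\<in>UNIV. x $ k)) / l = 1 / l + (\<Sum>k\<in>UNIV. x $ k)"
    using l by (simp add: add_divide_distrib)
  also have "\<dots> \<le> 1 / lam $ m + (\<Sum>k\<in>UNIV. lam $ k * x $ k) / lam $ m"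
    using assms(2,3) l load
    by (intro add_mono divide_left_mono) (auto simp: pos_le_divide_eq mult.commute)
  finally show ?thesis
    unfolding age_def by (simp add: sum_distrib_left add_divide_distrib)
qed

lemma sys_cost_uniform_le:
  assumes "\<And>n. 0 < x $ n" and "\<And>n. 0 < lam $ n" and "\<And>n. lam $ n \<le> l"
    and "\<And>n. mono_on {0..} (C n)"
    and same_x: "\<And>n m. x $ n = x $ m" and same_C: "\<And>n m A. 0 \<le> A \<Longrightarrow> C n A = C m A"
  shows "sys_cost x C (\<chi> k. l) \<le> sys_cost x C lam"
proof (rule sys_cost_le_if_dominated)
  fix n
  let ?u = "\<chi> k. l"
  obtain m where m: "\<And>k. lam $ m \<le> lam $ k"
    using ex_min_if_finite[of "range (($) lam)"] by (auto simp: not_less)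
  have nonneg: "0 \<le> age x ?u k" for k
    using assms(1) less_le_trans[OF assms(2) assms(3)] by (intro age_nonneg) auto
  have "C n (age x ?u n) = C m (age x ?u m)"
    using same_x[of n m] same_C[OF nonneg] by (simp add: age_def)
  also have "\<dots> \<le> C m (age x lam m)"
    using nonneg[of m] age_uniform_le_age_slowest[OF assms(1,2,3) m]
    by (intro mono_onD[OF assms(4)]) (auto intro: order_trans)
  finally show "\<exists>m. C n (age x ?u n) \<le> C m (age x lam m)" ..
qed

theorem lemma3:
  fixes x lam_opt :: "real ^ 'n"
    and lmin lmax :: real
    and C :: "'n \<Rightarrow> real \<Rightarrow> real"
  assumes "\<And>n. 0 < x $ n"
    and "0 < lmin" and "lmin \<le> lmax"
    and "\<And>n. quasiconvex_on {0..} (C n)"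
    and "\<And>n. mono_on {0..} (C n)"
    and "\<And>n. C n 0 = 0"
    and "optimal_rates lmin lmax x C lam_opt"
  shows "(\<exists>lam_hat. lam_opt \<le> lam_hat \<and> (MAX n. lam_hat $ n) = lmax \<and>
            sys_cost x C lam_hat = sys_cost x C lam_opt) \<and>
         ((\<forall>n m. x $ n = x $ m) \<and> (\<forall>n m. \<forall>A\<ge>0. C n A = C m A) \<longrightarrow>
            optimal_rates lmin lmax x C (\<chi> n. lmax))"
proof -
  have pos: "0 < lam $ n" if "lam \<in> rate_set lmin lmax" for lam :: "real ^ 'n" and n
    using that \<open>0 < lmin\<close> by (auto simp: rate_set_def intro: less_le_trans)
  have feas: "lam_opt \<in> rate_set lmin lmax"
    and opt: "\<And>mu. mu \<in> rate_set lmin lmax \<Longrightarrow> sys_cost x C lam_opt \<le> sys_cost x C mu"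
    using assms(7) by (auto simp: optimal_rates_def is_arg_min_def not_less)
  note opt_pos = pos[OF feas]
  obtain m where m: "\<And>k. lam_opt $ k \<le> lam_opt $ m"
    using ex_min_if_finite[of "range (\<lambda>k. - lam_opt $ k)"] by (auto simp: not_less)
  define c where "c = lmax / lam_opt $ m"
  have c: "1 \<le> c"
    using feas opt_pos[of m] by (simp add: c_def rate_set_def)
  have cm: "c * lam_opt $ m = lmax"
    using opt_pos[of m] by (simp add: c_def)
  have ge: "lam_opt $ k \<le> c * lam_opt $ k" for k
    using mult_right_mono[OF c, of "lam_opt $ k"] opt_pos[of k] by simp
  have le: "c * lam_opt $ k \<le> lmax" for k
    using mult_left_mono[OF m[of k], of c] c cm by simp
  have "c *\<^sub>R lam_opt \<in> rate_set lmin lmax"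
    using feas order_trans[OF _ ge] le by (auto simp: rate_set_def)
  then have "sys_cost x C (c *\<^sub>R lam_opt) = sys_cost x C lam_opt"
    using opt sys_cost_scale_le[OF assms(1) opt_pos c assms(5)] by (intro antisym)
  moreover have "lam_opt \<le> c *\<^sub>R lam_opt"
    using ge by (simp add: less_eq_vec_def)
  moreover have "(MAX n. (c *\<^sub>R lam_opt) $ n) = lmax"
    using le cm by (intro Max_eqI) (auto intro: rev_image_eqI)
  moreover have "optimal_rates lmin lmax x C (\<chi> n. lmax)"
    if same: "\<forall>n m. x $ n = x $ m" "\<forall>n m. \<forall>A\<ge>0. C n A = C m A"
  proof -
    have "sys_cost x C (\<chi> n. lmax) \<le> sys_cost x C lam" if "lam \<in> rate_set lmin lmax" for lam
      using assms(1,5) pos[OF that] that same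
      by (intro sys_cost_uniform_le) (auto simp: rate_set_def)
    then show ?thesis
      using \<open>lmin \<le> lmax\<close>
      by (auto simp: optimal_rates_def is_arg_min_def not_less rate_set_def)
  qed
  ultimately show ?thesis by blast
qed

end
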